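(* Let $n$ and $a$ be relatively prime positive integers and $s\ge1$, and assume the Euclidean algorithm with $n$ and $a$ (in the generalized sense described in the context) produces the symmetric sequence of quotients $q_1,\ldots,q_s,q_s,\ldots,q_1$ (of length $2s$), with remainders $r_1=n, r_2=a, r_3,\ldots, r_{2s+1}=1, r_{2s+2}=0$. Let $\mathfrak{c}_{i,j}$ be the continuants of the sequence $(q_1,\ldots,q_s)$. Then for $1\le i\le s+1$, $$r_i=\mathfrak{c}_{1,s}\mathfrak{c}_{i,s}+\mathfrak{c}_{1,s-1}\mathfrak{c}_{i,s-1}$$ and $$r_{2s-i+3}=\mathfrak{c}_{1,i-2}=(-1)^{i+s}\left(\mathfrak{c}_{1,s}\mathfrak{c}_{i,s-1}-\mathfrak{c}_{1,s-1}\mathfrak{c}_{i,s}\right).$$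
   Context: Generalized Euclidean algorithm: for a finite sequence $(u_1,\ldots,u_m)$ of positive integers, the remainders are $\rho_1,\ldots,\rho_{m+2}$ defined by $\rho_{m+2}=0$, $\rho_{m+1}=1$, $\rho_k=u_k\rho_{k+1}+\rho_{k+2}$ for $1\le k\le m$; we say the Euclidean algorithm with $n=\rho_1$ and $a=\rho_2$ produces the quotients $(u_1,\ldots,u_m)$ and remainders $\rho_1,\ldots,\rho_{m+2}$. This is the ordinary Euclidean algorithm except that the last quotient is allowed to equal $1$ (convention: an ordinary final step $r_l=q_l\cdot1+0$ may be rewritten as $r_l=(q_l-1)\cdot1+1$, $1=1\cdot1+0$). Here the quotient sequence is $u_k=q_k$ and $u_{2s+1-k}=q_k$ for $1\le k\le s$. Continuants: for a sequence $(u_1,\ldots,u_t)$ of positive integers and $1\le i\le j\le t$, $\mathfrak{c}_{i,j}$ is the determinant of the tridiagonal matrix with diagonal entries $u_i,\ldots,u_j$, superdiagonal entries $1$ and subdiagonal entries $-1$; also $\mathfrak{c}_{j+1,j}=1$ for $0\le j\le t$ and $\mathfrak{c}_{j+2,j}=0$ for $-1\le j\le t$. *)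

theory Defs
  imports "Jordan_Normal_Form.Determinant"
begin

text \<open>Finite sequences are functions with indices starting at 1; values outside the stated
  index range are irrelevant. The sequence of quotients is u(1), ..., u(m), the sequence of
  remainders is r(1), ..., r(m + 2). The last quotient u(m) may equal 1.\<close>

definition euclid_produces ::
  "nat \<Rightarrow> nat \<Rightarrow> nat \<Rightarrow> (nat \<Rightarrow> nat) \<Rightarrow> (nat \<Rightarrow> nat) \<Rightarrow> bool" where
  "euclid_produces n a m u r \<longleftrightarrow>
     (\<forall>k\<in>{1..m}. 0 < u k) \<and>
     r (m + 2) = 0 \<and> r (m + 1) = 1 \<and>
     (\<forall>k\<in>{1..m}. r k = u k * r (k + 1) + r (k + 2)) \<and>
     n = r 1 \<and> a = r 2"

definition symmetric_seq :: "nat \<Rightarrow> (nat \<Rightarrow> nat) \<Rightarrow> nat \<Rightarrow> nat" where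
  "symmetric_seq s q k = (if k \<le> s then q k else q (2 * s + 1 - k))"

text \<open>Matrix positions are counted from 0, so the diagonal entry at position k is u(i + k).\<close>

definition continuant_mat :: "(nat \<Rightarrow> nat) \<Rightarrow> int \<Rightarrow> int \<Rightarrow> int mat" where
  "continuant_mat u i j = mat (nat (j - i + 1)) (nat (j - i + 1))
     (\<lambda>(k, l). if k = l then int (u (nat i + k))
               else if l = k + 1 then 1
               else if k = l + 1 then - 1
               else 0)"

text \<open>The indices are integers because the second one can be -1. The first index is at least 1
  in all intended uses. The value 0 is a convention for i = j + 2 and a dummy for i > j + 2.\<close>

definition continuant :: "(nat \<Rightarrow> nat) \<Rightarrow> int \<Rightarrow> int \<Rightarrow> int" where
  "continuant u i j =
     (if i \<le> j then det (continuant_mat u i j)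
      else if i = j + 1 then 1
      else 0)"

end

theory Submission
  imports Defs
begin

text \<open>The continuants satisfy a recurrence at the first index (expand the determinant) and, as a
  consequence, one at the last index. Each equation of the theorem then compares two solutions of
  the same recurrence \<open>x k = u k * x (k + 1) + x (k + 2)\<close> that agree at two consecutive indices.
  The second equation is obtained on the second half of the quotient sequence, whose symmetry turns
  the recurrence at the last index into that of the remainders; it supplies the initial values for
  the first equation, on the first half. For the third one, the sign \<open>(- 1) ^ (i + s)\<close> turns the
  recurrence at the last index, solved for its last term, into the same form.\<close>

text \<open>Laplace expansion along the first column, whose only nonzero entries are
  \<open>u m\<close> and -1. The minor \<open>?B\<close> at the -1 has first row 1, 0, ..., 0, so a
  second expansion leaves the block starting at \<open>m + 2\<close>; the cofactor sign cancels the
  -1.\<close>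

lemma det_continuant_mat_rec:
  fixes m N :: nat and u :: "nat \<Rightarrow> nat"
  defines "T \<equiv> (\<lambda>m N. mat N N (\<lambda>(k, l). if k = l then int (u (m + k))
               else if l = k + 1 then 1
               else if k = l + 1 then - 1
               else 0))"
  shows "det (T m (Suc (Suc N))) = int (u m) * det (T (Suc m) (Suc N)) + det (T (Suc (Suc m)) N)"
proof -
  let ?A = "T m (Suc (Suc N))"
  let ?B = "mat_delete ?A 1 0"
  have A: "?A \<in> carrier_mat (Suc (Suc N)) (Suc (Suc N))" by (simp add: T_def)
  have B: "?B \<in> carrier_mat (Suc N) (Suc N)" by (simp add: T_def mat_delete_def)
  have d00: "mat_delete ?A 0 0 = T (Suc m) (Suc N)"
    by (rule eq_matI) (auto simp: T_def mat_delete_def)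
  have dB: "mat_delete ?B 0 0 = T (Suc (Suc m)) N"
    by (rule eq_matI) (auto simp: T_def mat_delete_def)
  have "det ?B = (\<Sum>l<Suc N. ?B $$ (0, l) * cofactor ?B 0 l)"
    by (rule laplace_expansion_row[OF B]) simp
  also have "\<dots> = ?B $$ (0, 0) * cofactor ?B 0 0"
    unfolding sum.lessThan_Suc_shift by (auto simp: T_def mat_delete_def intro!: sum.neutral)
  also have "\<dots> = det (T (Suc (Suc m)) N)"
    unfolding cofactor_def dB by (simp add: T_def mat_delete_def)
  finally have detB: "det ?B = det (T (Suc (Suc m)) N)" .
  have "det ?A = (\<Sum>k<Suc (Suc N). ?A $$ (k, 0) * cofactor ?A k 0)"
    by (rule laplace_expansion_column[OF A]) simp
  also have "\<dots> = ?A $$ (0, 0) * cofactor ?A 0 0 + ?A $$ (1, 0) * cofactor ?A 1 0"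
    unfolding sum.lessThan_Suc_shift by (auto simp: T_def intro!: sum.neutral)
  also have "\<dots> = int (u m) * det (T (Suc m) (Suc N)) + det (T (Suc (Suc m)) N)"
    unfolding cofactor_def d00 detB by (simp add: T_def)
  finally show ?thesis .
qed

lemma continuant_rec_left:
  assumes "int i \<le> j"
  shows "continuant u (int i) j =
    int (u i) * continuant u (int i + 1) j + continuant u (int i + 2) j"
proof (cases "int i = j")
  case True
  have "det (continuant_mat u (int i) (int i)) = int (u i)"
    by (subst det_single) (auto simp: continuant_mat_def)
  with True show ?thesis by (simp add: continuant_def)
next
  case False
  define N where "N = nat (j - int i - 1)"
  have j: "j = int i + 1 + int N" using assms False by (simp add: N_def)
  have sizes: "nat (j - int i + 1) = Suc (Suc N)" "nat (j - int (Suc i) + 1) = Suc N"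
    "nat (j - int (Suc (Suc i)) + 1) = N"
    unfolding j by simp_all
  have "det (continuant_mat u (int i) j) = int (u i) * det (continuant_mat u (int (Suc i)) j)
      + det (continuant_mat u (int (Suc (Suc i))) j)"
    unfolding continuant_mat_def sizes nat_int by (rule det_continuant_mat_rec)
  moreover have "det (continuant_mat u (int (Suc (Suc i))) j) = continuant u (int i + 2) j"
  \<comment> \<open>For \<open>N = 0\<close> the determinant of the empty matrix agrees with the
    conventional value 1, which \<open>continuant\<close> takes from its second branch.\<close>
  proof (cases "N = 0")
    case True
    then have "det (continuant_mat u (int (Suc (Suc i))) j) = 1"
      unfolding continuant_mat_def sizes by (intro det_dim_zero) simp
    with True j show ?thesis by (simp add: continuant_def)
  next
    case False
    with j show ?thesis by (simp add: continuant_def add.commute)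
  qed
  ultimately show ?thesis using j by (simp add: continuant_def add.commute)
qed

text \<open>Induction on the length: expanding all three continuants at their first index reduces
  the claim for \<open>i\<close> to those for \<open>i + 1\<close> and \<open>i + 2\<close>. The
  shortest of these expansions needs \<open>i + 2 \<le> j\<close>, so lengths one and two are base
  cases settled by the conventions.\<close>

lemma continuant_rec_right:
  assumes "i \<le> j"
  shows "continuant u (int i) (int j) =
    int (u j) * continuant u (int i) (int j - 1) + continuant u (int i) (int j - 2)"
  using assms
proof (induction "j - i" arbitrary: i rule: less_induct)
  case less
  note left = continuant_rec_left[of i _ u]
  consider "j = i" | "j = i + 1" | "i + 2 \<le> j" using less.prems by linarith
  then show ?case
  proof cases
    case 1
    then show ?thesis using left[of "int j"] by (simp add: continuant_def[of _ "int i + _"] continuant_def[of _ "int i" "int i - _"])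
  next
    case 2
    then show ?thesis
      using left[of "int j"] left[of "int i"] continuant_rec_left[of j "int j" u]
      by (simp add: continuant_def[of _ "_ + _"] continuant_def[of _ "int i" "int i - _"] algebra_simps)
  next
    case 3
    then show ?thesis
      using less.hyps[of "i + 1"] less.hyps[of "i + 2"] left[of "int j"] left[of "int j - 1"]
        left[of "int j - 2"]
      by (simp add: algebra_simps)
  qed
qed

text \<open>The recurrence determines each term from the two after it, so the induction descends
  from the initial values at \<open>m\<close> and \<open>m + 1\<close>. The bound \<open>l\<close>
  allows either half of the quotient sequence to be treated alone.\<close>

lemma euclid_rec_unique:
  fixes x y u :: "nat \<Rightarrow> 'a::semiring"
  assumes "\<And>k. l \<le> k \<Longrightarrow> k < m \<Longrightarrow> x k = u k * x (k + 1) + x (k + 2)"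
    and "\<And>k. l \<le> k \<Longrightarrow> k < m \<Longrightarrow> y k = u k * y (k + 1) + y (k + 2)"
    and "x m = y m" and "x (m + 1) = y (m + 1)"
    and "l \<le> k" and "k \<le> m + 1"
  shows "x k = y k"
  using assms(5,6)
proof (induction "m + 1 - k" arbitrary: k rule: less_induct)
  case less
  show ?case
  proof (cases "k < m")
    case True
    then have "x (k + 1) = y (k + 1)" "x (k + 2) = y (k + 2)" using less by auto
    then show ?thesis using assms(1,2) True less.prems by simp
  next
    case False
    then have "k = m \<or> k = m + 1" using less.prems by linarith
    then show ?thesis using assms(3,4) by blast
  qed
qed

theorem theorem1:
  fixes n a s i :: nat and q r :: "nat \<Rightarrow> nat"
  assumes "0 < n" and "0 < a" and "coprime n a" and "1 \<le> s"
    and "euclid_produces n a (2 * s) (symmetric_seq s q) r"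
    and "1 \<le> i" and "i \<le> s + 1"
  shows "int (r i) =
           continuant q 1 (int s) * continuant q (int i) (int s)
           + continuant q 1 (int s - 1) * continuant q (int i) (int s - 1)
         \<and> int (r (2 * s + 3 - i)) = continuant q 1 (int i - 2)
         \<and> continuant q 1 (int i - 2) =
           (- 1) ^ (i + s) *
           (continuant q 1 (int s) * continuant q (int i) (int s - 1)
            - continuant q 1 (int s - 1) * continuant q (int i) (int s))"
proof -
  let ?c = "continuant q"
  let ?u = "\<lambda>k. int (symmetric_seq s q k)"
  have r_end: "r (2 * s + 1) = 1" "r (2 * s + 2) = 0"
    using assms(5) by (simp_all add: euclid_produces_def)
  have r_nat: "r k = symmetric_seq s q k * r (k + 1) + r (k + 2)" if "1 \<le> k" "k \<le> 2 * s" for k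
    using assms(5) that by (simp add: euclid_produces_def)
  have r_rec: "int (r k) = ?u k * int (r (k + 1)) + int (r (k + 2))" if "1 \<le> k" "k \<le> 2 * s" for k
    using r_nat[OF that] by (metis of_nat_add of_nat_mult)
  have left: "?c (int k) j = int (q k) * ?c (int k + 1) j + ?c (int k + 2) j" if "int k \<le> j" for k j
    by (rule continuant_rec_left[OF that])
  have right: "?c 1 (int k) = int (q k) * ?c 1 (int k - 1) + ?c 1 (int k - 2)" if "1 \<le> k" for k
    using continuant_rec_right[OF that, of q] by simp
  have ends: "?c (int j + 1) (int j) = 1" "?c (int j + 1) (int j - 1) = 0"
     "?c (int j) (int j - 1) = 1" for j
    by (simp_all add: continuant_def)

  \<comment> \<open>For \<open>k > s\<close> the quotient is \<open>q (2 * s + 1 - k)\<close>, the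
    coefficient of \<open>right\<close> at \<open>2 * s + 1 - k\<close>. The initial values are the
    conventions \<open>?c 1 0 = 1\<close> and \<open>?c 1 (-1) = 0\<close>.\<close>
  have upper: "int (r k) = ?c 1 (2 * int s + 1 - int k)" if "s + 1 \<le> k" "k \<le> 2 * s + 2" for k
  proof (rule euclid_rec_unique[where l = "s + 1" and m = "2 * s + 1" and u = ?u
      and x = "\<lambda>k. int (r k)" and y = "\<lambda>k. ?c 1 (2 * int s + 1 - int k)"])
    show "?c 1 (2 * int s + 1 - int k) =
        ?u k * ?c 1 (2 * int s + 1 - int (k + 1)) + ?c 1 (2 * int s + 1 - int (k + 2))"
      if "s + 1 \<le> k" "k < 2 * s + 1" for k
      using right[of "2 * s + 1 - k"] that by (simp add: symmetric_seq_def of_nat_diff algebra_simps)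
  qed (use that r_rec r_end assms(4) in \<open>simp_all add: continuant_def\<close>)

  have diag: "?c (int s) (int s) = int (q s)"
    using left[of s "int s"] by (simp add: continuant_def[of _ "int s + _"])
  have middle: "int (r (s + 1)) = ?c 1 (int s)" "int (r (s + 2)) = ?c 1 (int s - 1)"
    using upper[of "s + 1"] upper[of "s + 2"] assms(4) by simp_all

  \<comment> \<open>The descent starts at \<open>s\<close> and \<open>s + 1\<close>, not one index
    later: for second index \<open>s - 1\<close> the left recurrence fails at \<open>k = s\<close>,
    where it would read 1 = 0. The value at \<open>s\<close> comes from one Euclidean step
    instead.\<close>
  have lower: "int (r i) = ?c 1 (int s) * ?c (int i) (int s) + ?c 1 (int s - 1) * ?c (int i) (int s - 1)"
  proof (rule euclid_rec_unique[where l = 1 and m = s and u = ?u and x = "\<lambda>k. int (r k)"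
      and y = "\<lambda>k. ?c 1 (int s) * ?c (int k) (int s) + ?c 1 (int s - 1) * ?c (int k) (int s - 1)"])
    show "int (r s) = ?c 1 (int s) * ?c (int s) (int s) + ?c 1 (int s - 1) * ?c (int s) (int s - 1)"
      using r_rec[of s] assms(4) unfolding middle diag ends by (simp add: symmetric_seq_def)
    show "int (r (s + 1)) =
        ?c 1 (int s) * ?c (int (s + 1)) (int s) + ?c 1 (int s - 1) * ?c (int (s + 1)) (int s - 1)"
      using middle(1) ends[of s] by (simp add: add.commute)
    show "?c 1 (int s) * ?c (int k) (int s) + ?c 1 (int s - 1) * ?c (int k) (int s - 1) =
        ?u k * (?c 1 (int s) * ?c (int (k + 1)) (int s) + ?c 1 (int s - 1) * ?c (int (k + 1)) (int s - 1))
        + (?c 1 (int s) * ?c (int (k + 2)) (int s) + ?c 1 (int s - 1) * ?c (int (k + 2)) (int s - 1))"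
      if "1 \<le> k" "k < s" for k
      using that left[of k "int s"] left[of k "int s - 1"]
      by (simp add: symmetric_seq_def algebra_simps)
  qed (use assms r_rec in simp_all)

  have signed: "(- 1) ^ (i + s) * ?c 1 (int i - 2) =
      ?c 1 (int s) * ?c (int i) (int s - 1) - ?c 1 (int s - 1) * ?c (int i) (int s)"
  proof (rule euclid_rec_unique[where l = 1 and m = s and u = "\<lambda>k. int (q k)"
      and x = "\<lambda>k. (- 1) ^ (k + s) * ?c 1 (int k - 2)"
      and y = "\<lambda>k. ?c 1 (int s) * ?c (int k) (int s - 1) - ?c 1 (int s - 1) * ?c (int k) (int s)"])
    show "(- 1) ^ (k + s) * ?c 1 (int k - 2) =
        int (q k) * ((- 1) ^ (k + 1 + s) * ?c 1 (int (k + 1) - 2))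
        + (- 1) ^ (k + 2 + s) * ?c 1 (int (k + 2) - 2)"
      if "1 \<le> k" for k
      using right[OF that] by (simp add: algebra_simps)
    show "?c 1 (int s) * ?c (int k) (int s - 1) - ?c 1 (int s - 1) * ?c (int k) (int s) =
        int (q k) * (?c 1 (int s) * ?c (int (k + 1)) (int s - 1) - ?c 1 (int s - 1) * ?c (int (k + 1)) (int s))
        + (?c 1 (int s) * ?c (int (k + 2)) (int s - 1) - ?c 1 (int s - 1) * ?c (int (k + 2)) (int s))"
      if "1 \<le> k" "k < s" for k
      using that left[of k "int s"] left[of k "int s - 1"] by (simp add: algebra_simps)
    \<comment> \<open>The exponent is even, so this is \<open>right\<close> at \<open>s\<close>
      solved for its last term.\<close>
    show "(- 1) ^ (s + s) * ?c 1 (int s - 2) =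
        ?c 1 (int s) * ?c (int s) (int s - 1) - ?c 1 (int s - 1) * ?c (int s) (int s)"
      using right[OF assms(4)] unfolding diag ends by (simp flip: mult_2)
    show "(- 1) ^ (s + 1 + s) * ?c 1 (int (s + 1) - 2) =
        ?c 1 (int s) * ?c (int (s + 1)) (int s - 1) - ?c 1 (int s - 1) * ?c (int (s + 1)) (int s)"
      using ends[of s] by (simp add: algebra_simps flip: mult_2)
  qed (use assms in simp_all)

  \<comment> \<open>The index \<open>2 * s + 3 - i\<close> runs from \<open>s + 2\<close> to
    \<open>2 * s + 2\<close>, inside the range of \<open>upper\<close>.\<close>
  have "int (r (2 * s + 3 - i)) = ?c 1 (int i - 2)"
    using upper[of "2 * s + 3 - i"] assms(6,7) by (simp add: of_nat_diff algebra_simps)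
  \<comment> \<open>The sign is its own inverse, which moves it to the other side of
    \<open>signed\<close>.\<close>
  moreover have "?c 1 (int i - 2) = (- 1) ^ (i + s) * ((- 1) ^ (i + s) * ?c 1 (int i - 2))"
    by (simp flip: mult.assoc power_mult_distrib)
  ultimately show ?thesis using lower unfolding signed by blast
qed

end
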